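(* Let $G$ be a connected graph with at least two vertices and girth at least $7$ (trees included). Then $\dim_{n\ell}(G)\le \beta'(G)-1$. Moreover, if $G$ is a tree, then $\dim_{n\ell}(G)=\beta'(G)-1$ if and only if $G$ is obtained from a star $K_{1,m}$ ($m\ge 1$) by keeping one of its edges unchanged and subdividing each of the remaining edges at most once (i.e., replacing each remaining edge either by itself or by a path of length $2$).
   Context: Graphs are finite, simple and connected; $d_G(u,v)$ is the shortest-path distance. The girth is the length of a shortest cycle (infinite for acyclic graphs). The edge cover number $\beta'(G)$ is the minimum number of edges such that every vertex is incident with at least one of them. A set $X\subseteq V(G)$ resolves two vertices $u,v$ if some $x\in X$ satisfies $d_G(u,x)\neq d_G(v,x)$. $X$ is a nonlocal resolving set if it resolves every pair of distinct non-adjacent vertices; the nonlocal metric dimension $\dim_{n\ell}(G)$ is the minimum size of a nonlocal resolving set (so $\dim_{n\ell}(K_n)=0$). *)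

theory Defs
  imports Main "HOL-Library.Extended_Nat"
begin

definition graph :: "'a set \<Rightarrow> 'a set set \<Rightarrow> bool" where
  "graph V E \<longleftrightarrow> finite V \<and>
     (\<forall>e\<in>E. \<exists>u v. u \<noteq> v \<and> u \<in> V \<and> v \<in> V \<and> e = {u, v})"

definition walk_len :: "'a set set \<Rightarrow> 'a \<Rightarrow> 'a \<Rightarrow> nat \<Rightarrow> bool" where
  "walk_len E u v n \<longleftrightarrow> (\<exists>xs. length xs = Suc n \<and> hd xs = u \<and> last xs = v \<and>
      (\<forall>i<n. {xs ! i, xs ! Suc i} \<in> E))"

definition connected :: "'a set \<Rightarrow> 'a set set \<Rightarrow> bool" where
  "connected V E \<longleftrightarrow> (\<forall>u\<in>V. \<forall>v\<in>V. \<exists>n. walk_len E u v n)"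

text \<open>Shortest-path distance (meaningful for connected graphs).\<close>
definition dist :: "'a set set \<Rightarrow> 'a \<Rightarrow> 'a \<Rightarrow> nat" where
  "dist E u v = (LEAST n. walk_len E u v n)"

definition is_cycle :: "'a set \<Rightarrow> 'a set set \<Rightarrow> 'a list \<Rightarrow> bool" where
  "is_cycle V E cs \<longleftrightarrow> length cs \<ge> 3 \<and> distinct cs \<and> set cs \<subseteq> V \<and>
     (\<forall>i. Suc i < length cs \<longrightarrow> {cs ! i, cs ! Suc i} \<in> E) \<and> {last cs, hd cs} \<in> E"

text \<open>Girth: length of a shortest cycle, infinity if there is none.\<close>
definition girth :: "'a set \<Rightarrow> 'a set set \<Rightarrow> enat" where
  "girth V E = Inf ((\<lambda>cs. enat (length cs)) ` {cs. is_cycle V E cs})"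

definition is_tree :: "'a set \<Rightarrow> 'a set set \<Rightarrow> bool" where
  "is_tree V E \<longleftrightarrow> connected V E \<and> \<not> (\<exists>cs. is_cycle V E cs)"

definition edge_cover :: "'a set \<Rightarrow> 'a set set \<Rightarrow> 'a set set \<Rightarrow> bool" where
  "edge_cover V E C \<longleftrightarrow> C \<subseteq> E \<and> (\<forall>v\<in>V. \<exists>e\<in>C. v \<in> e)"

definition edge_cover_number :: "'a set \<Rightarrow> 'a set set \<Rightarrow> nat" where
  "edge_cover_number V E = (LEAST k. \<exists>C. edge_cover V E C \<and> card C = k)"

definition nonlocal_resolving :: "'a set \<Rightarrow> 'a set set \<Rightarrow> 'a set \<Rightarrow> bool" where
  "nonlocal_resolving V E X \<longleftrightarrow> X \<subseteq> V \<and>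
     (\<forall>u\<in>V. \<forall>v\<in>V. u \<noteq> v \<and> {u, v} \<notin> E \<longrightarrow> (\<exists>x\<in>X. dist E u x \<noteq> dist E v x))"

definition nl_dim :: "'a set \<Rightarrow> 'a set set \<Rightarrow> nat" where
  "nl_dim V E = (LEAST k. \<exists>X. nonlocal_resolving V E X \<and> card X = k)"

text \<open>G is obtained from the star K_{1,m} with centre c and leaf set L (m = card L >= 1)
  by keeping the edge {c,l0} and subdividing exactly the edges {c,l}, l in S (S avoids l0),
  each by a new vertex s l.\<close>
definition star_subdivision :: "'a set \<Rightarrow> 'a set set \<Rightarrow> bool" where
  "star_subdivision V E \<longleftrightarrow> (\<exists>c L l0 S s.
     finite L \<and> l0 \<in> L \<and> c \<notin> L \<and> S \<subseteq> L - {l0} \<and> inj_on s S \<and>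
     s ` S \<inter> insert c L = {} \<and>
     V = insert c L \<union> s ` S \<and>
     E = (\<lambda>l. {c, l}) ` (L - S) \<union> (\<lambda>l. {c, s l}) ` S \<union> (\<lambda>l. {s l, l}) ` S)"

end

theory Submission
  imports Defs
begin

text \<open>
  By minimality, every edge \<open>e\<close> of a minimum edge cover has an end \<open>f e\<close> that no other edge of the
  cover contains. If two edges of the cover meet, then all these ends but one of the two belonging to
  the meeting edges form a nonlocal resolving set: an unresolved pair closes a cycle of length 4 or 6.
  If the cover is a matching, drop one edge \<open>{c, l}\<close> and take from every other edge an end adjacent
  to neither \<open>c\<close> nor \<open>l\<close>; it exists, as otherwise there is a cycle of length 3 or 4.

  In a tree, extending the geodesic from \<open>w\<close> to \<open>u\<close> beyond \<open>u\<close> ends in a leaf that resolves \<open>u\<close> and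
  \<open>w\<close>. There is such a leaf behind \<open>u\<close> and another one behind \<open>w\<close>, so all leaves but one resolve the
  tree. Every edge cover contains the pendant edges, hence in the extremal case these are the whole
  cover and every inner vertex has a pendant leaf. Dropping two leaves attached to inner
  vertices \<open>p \<noteq> q\<close> must then leave some pair unresolved; if \<open>q\<close> has degree at least 3, this forces \<open>p\<close>
  to be adjacent to \<open>q\<close> and to have degree 2. Conversely, in a subdivided star a nonlocal resolving
  set meets all branches at the centre except at most one.
\<close>

section \<open>Walks and distances\<close>

lemma walk_len_0 [simp]: "walk_len E u v 0 \<longleftrightarrow> u = v"
  by (auto simp: walk_len_def length_Suc_conv intro: exI[of _ "[v]"])

lemma walk_len_Suc: "walk_len E u w (Suc n) \<longleftrightarrow> (\<exists>v. {u, v} \<in> E \<and> walk_len E v w n)"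
proof
  assume "walk_len E u w (Suc n)"
  then obtain xs where xs: "length xs = Suc (Suc n)" "hd xs = u" "last xs = w"
    "\<forall>i<Suc n. {xs ! i, xs ! Suc i} \<in> E"
    unfolding walk_len_def by blast
  then obtain y ys where ys: "xs = u # y # ys" by (auto simp: length_Suc_conv)
  have "{u, y} \<in> E" using xs(4) ys by force
  moreover have "walk_len E y w n"
    unfolding walk_len_def
  proof (intro exI[of _ "y # ys"] conjI)
    show "\<forall>i<n. {(y # ys) ! i, (y # ys) ! Suc i} \<in> E"
      using xs(4) ys by (metis Suc_less_eq nth_Cons_Suc)
  qed (use xs ys in auto)
  ultimately show "\<exists>v. {u, v} \<in> E \<and> walk_len E v w n" by blast
next
  assume "\<exists>v. {u, v} \<in> E \<and> walk_len E v w n"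
  then obtain v xs where e: "{u, v} \<in> E" and xs: "length xs = Suc n" "hd xs = v" "last xs = w"
    "\<forall>i<n. {xs ! i, xs ! Suc i} \<in> E"
    unfolding walk_len_def by blast
  have "{(u # xs) ! i, (u # xs) ! Suc i} \<in> E" if "i < Suc n" for i
    using that e xs by (cases i) (auto simp: length_Suc_conv)
  then show "walk_len E u w (Suc n)"
    unfolding walk_len_def using xs by (intro exI[of _ "u # xs"]) auto
qed

lemma walk_len_mono: "walk_len E u v n \<Longrightarrow> E \<subseteq> F \<Longrightarrow> walk_len F u v n"
  unfolding walk_len_def by blast

lemma walk_len_trans: "walk_len E u v m \<Longrightarrow> walk_len E v w n \<Longrightarrow> walk_len E u w (m + n)"
  by (induction m arbitrary: u) (auto simp: walk_len_Suc)

lemma walk_len_sym: "walk_len E u v n \<Longrightarrow> walk_len E v u n"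
proof (induction n arbitrary: u)
  case (Suc n)
  then obtain y where "{u, y} \<in> E" "walk_len E v y n" by (auto simp: walk_len_Suc)
  moreover have "walk_len E y u (Suc 0)"
    using \<open>{u, y} \<in> E\<close> by (auto simp: walk_len_Suc insert_commute)
  ultimately show ?case using walk_len_trans by fastforce
qed simp

lemma dist_commute: "dist E u v = dist E v u"
proof -
  have "walk_len E u v = walk_len E v u" by (intro ext iffI) (rule walk_len_sym, assumption)+
  then show ?thesis by (simp add: dist_def)
qed

lemma dist_self [simp]: "dist E u u = 0"
  unfolding dist_def by (rule Least_equality) auto

lemma dist_le: "walk_len E u v n \<Longrightarrow> dist E u v \<le> n"
  unfolding dist_def by (rule Least_le)

text \<open>Induction on the length, prepending \<open>u\<close>; if \<open>u\<close> already occurs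
  in the tail, everything before that occurrence is cut off.\<close>

lemma ex_distinct_walk:
  assumes "walk_len E u v n"
  shows "\<exists>xs. xs \<noteq> [] \<and> distinct xs \<and> hd xs = u \<and> last xs = v \<and>
    (\<forall>i. Suc i < length xs \<longrightarrow> {xs ! i, xs ! Suc i} \<in> E)"
  using assms
proof (induction n arbitrary: u)
  case 0
  then show ?case by (intro exI[of _ "[u]"]) auto
next
  case (Suc n)
  then obtain y xs where y: "{u, y} \<in> E" and xs: "xs \<noteq> []" "distinct xs" "hd xs = y" "last xs = v"
    "\<forall>i. Suc i < length xs \<longrightarrow> {xs ! i, xs ! Suc i} \<in> E"
    unfolding walk_len_Suc by blast
  show ?case
  proof (cases "u \<in> set xs")
    case True
    then obtain k where k: "k < length xs" "xs ! k = u" by (auto simp: in_set_conv_nth)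
    then show ?thesis using xs
      by (intro exI[of _ "drop k xs"]) (auto simp: hd_drop_conv_nth less_diff_conv ac_simps)
  next
    case False
    have "{(u # xs) ! i, (u # xs) ! Suc i} \<in> E" if "Suc i < length (u # xs)" for i
      using that y xs by (cases i) (auto simp: hd_conv_nth)
    then show ?thesis using xs False by (intro exI[of _ "u # xs"]) auto
  qed
qed

section \<open>Connected graphs\<close>

locale connected_graph =
  fixes V :: "'a set" and E :: "'a set set"
  assumes graph: "graph V E" and connected: "connected V E"
begin

abbreviation d :: "'a \<Rightarrow> 'a \<Rightarrow> nat" where "d \<equiv> dist E"

definition leaf :: "'a \<Rightarrow> bool" where "leaf x \<longleftrightarrow> (\<exists>!y. {x, y} \<in> E)"

definition leaves :: "'a set" where "leaves = {x. leaf x}"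

lemma finite_V: "finite V"
  using graph by (simp add: graph_def)

lemma edgeD:
  assumes "{u, v} \<in> E"
  shows "u \<in> V" "v \<in> V" "u \<noteq> v" "{v, u} \<in> E"
  using assms graph unfolding graph_def by (auto simp: doubleton_eq_iff insert_commute)

lemma edgeE:
  assumes "e \<in> E"
  obtains u v where "e = {u, v}" "u \<noteq> v" "u \<in> V" "v \<in> V"
  using assms graph unfolding graph_def by blast

lemma finite_E: "finite E"
proof (rule finite_subset)
  show "E \<subseteq> Pow V" by (auto elim!: edgeE)
qed (simp add: finite_V)

lemma walk_len_dist: "u \<in> V \<Longrightarrow> v \<in> V \<Longrightarrow> walk_len E u v (d u v)"
  unfolding dist_def using connected by (metis LeastI connected_def)

lemma dist_eq_0_iff: "u \<in> V \<Longrightarrow> v \<in> V \<Longrightarrow> d u v = 0 \<longleftrightarrow> u = v"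
  using walk_len_dist[of u v] by auto

lemma dist_triangle: "u \<in> V \<Longrightarrow> v \<in> V \<Longrightarrow> w \<in> V \<Longrightarrow> d u w \<le> d u v + d v w"
  by (rule dist_le, rule walk_len_trans[of E u v]) (auto intro: walk_len_dist)

lemma dist_edge: "{u, v} \<in> E \<Longrightarrow> d u v = 1"
proof -
  assume e: "{u, v} \<in> E"
  then have "d u v \<le> Suc 0" by (intro dist_le) (auto simp: walk_len_Suc)
  then show ?thesis using dist_eq_0_iff[of u v] edgeD[OF e] by auto
qed

lemma dist_edge_le: "{u, v} \<in> E \<Longrightarrow> w \<in> V \<Longrightarrow> d u w \<le> Suc (d v w)"
  using dist_triangle[of u v w] dist_edge[of u v] edgeD[of u v] by auto

text \<open>The first step of a geodesic. Iterating it replaces explicit shortest paths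
  throughout.\<close>

lemma ex_closer:
  assumes "u \<in> V" "w \<in> V" "u \<noteq> w"
  obtains v where "{u, v} \<in> E" "d u w = Suc (d v w)"
proof -
  obtain n where n: "d u w = Suc n"
    using assms dist_eq_0_iff not0_implies_Suc by metis
  then obtain v where v: "{u, v} \<in> E" "walk_len E v w n"
    using walk_len_dist[OF assms(1,2)] walk_len_Suc by metis
  then have "d u w = Suc (d v w)"
    using dist_le[OF v(2)] dist_edge_le[OF v(1) assms(2)] n by simp
  with v that show thesis by blast
qed

lemma dist_eq_1_iff: "u \<in> V \<Longrightarrow> v \<in> V \<Longrightarrow> d u v = 1 \<longleftrightarrow> {u, v} \<in> E"
proof
  assume "u \<in> V" "v \<in> V" "d u v = 1"
  then obtain y where "{u, y} \<in> E" "d y v = 0" 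
    using ex_closer[of u v] by (metis One_nat_def Suc_inject dist_self zero_neq_one)
  then show "{u, v} \<in> E" using dist_eq_0_iff[of y v] edgeD \<open>v \<in> V\<close> by auto
qed (rule dist_edge)

lemma dist_eq_2D:
  assumes "u \<in> V" "v \<in> V" "d u v = 2"
  obtains y where "{u, y} \<in> E" "{y, v} \<in> E"
proof -
  have "u \<noteq> v" using assms(3) by auto
  then obtain y where "{u, y} \<in> E" "d u v = Suc (d y v)" using ex_closer assms by metis
  with assms that edgeD dist_eq_1_iff[of y v] show thesis by auto
qed

section \<open>Attained minima and a criterion for nonlocal resolving sets\<close>

lemma nl_dim_le: "nonlocal_resolving V E X \<Longrightarrow> nl_dim V E \<le> card X"
  unfolding nl_dim_def by (rule Least_le) blast

lemma ex_min_nonlocal_resolving: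
  obtains X where "nonlocal_resolving V E X" "card X = nl_dim V E"
proof -
  have "nonlocal_resolving V E V"
    unfolding nonlocal_resolving_def by (metis dist_eq_0_iff order_refl)
  then have "\<exists>k X. nonlocal_resolving V E X \<and> card X = k" by blast
  then have "\<exists>X. nonlocal_resolving V E X \<and> card X = nl_dim V E"
    unfolding nl_dim_def by (rule LeastI_ex)
  with that show thesis by blast
qed

lemma edge_cover_number_le: "edge_cover V E C \<Longrightarrow> edge_cover_number V E \<le> card C"
  unfolding edge_cover_number_def by (rule Least_le) blast

lemma ex_min_edge_cover:
  assumes "card V \<ge> 2"
  obtains C where "edge_cover V E C" "card C = edge_cover_number V E"
proof -
  have "\<exists>e\<in>E. v \<in> e" if v: "v \<in> V" for v
  proof -
    obtain w where "w \<in> V" "w \<noteq> v"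
      using assms by (metis card_le_Suc0_iff_eq finite_V not_less_eq_eq numeral_2_eq_2)
    then obtain y where "{v, y} \<in> E" using ex_closer[of v w] v by metis
    then show ?thesis by blast
  qed
  then have "edge_cover V E E" by (auto simp: edge_cover_def)
  then have "\<exists>k C. edge_cover V E C \<and> card C = k" by blast
  then have "\<exists>C. edge_cover V E C \<and> card C = edge_cover_number V E"
    unfolding edge_cover_number_def by (rule LeastI_ex)
  with that show thesis by blast
qed

text \<open>A member of \<open>X\<close> is the only vertex at distance 0 from itself, so it
  resolves every pair containing it. Only pairs outside \<open>X\<close> remain to be
  checked.\<close>

lemma nonlocal_resolvingI:
  assumes "X \<subseteq> V"
    and "\<And>u v. u \<in> V \<Longrightarrow> v \<in> V \<Longrightarrow> u \<noteq> v \<Longrightarrow> {u, v} \<notin> E \<Longrightarrow> u \<notin> X \<Longrightarrow> v \<notin> X \<Longrightarrow>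
      (\<And>x. x \<in> X \<Longrightarrow> d u x = d v x) \<Longrightarrow> False"
  shows "nonlocal_resolving V E X"
  unfolding nonlocal_resolving_def
proof (intro conjI ballI impI, fact)
  fix u v assume uv: "u \<in> V" "v \<in> V" "u \<noteq> v \<and> {u, v} \<notin> E"
  show "\<exists>x\<in>X. d u x \<noteq> d v x"
  proof (rule ccontr)
    assume n: "\<not> ?thesis"
    then have "u \<notin> X" "v \<notin> X"
      using uv dist_eq_0_iff dist_self by (metis)+
    then show False using assms(2)[of u v] uv n by auto
  qed
qed

lemma cycle_from_walk:
  assumes e: "{x, y} \<in> E" and w: "walk_len (E - {{x, y}}) x y n"
  shows "\<exists>cs. is_cycle V E cs"
proof -
  obtain xs where xs: "xs \<noteq> []" "distinct xs" "hd xs = x" "last xs = y"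
    "\<And>i. Suc i < length xs \<Longrightarrow> {xs ! i, xs ! Suc i} \<in> E - {{x, y}}"
    using ex_distinct_walk[OF w] by blast
  have len: "length xs \<ge> 3"
  proof (rule ccontr)
    assume "\<not> ?thesis"
    moreover have "length xs \<noteq> 0" using xs(1) by simp
    ultimately have "length xs = 1 \<or> length xs = 2" by linarith
    then show False
    proof
      assume "length xs = 1"
      then show False using xs(3,4) edgeD[OF e] by (auto simp: length_Suc_conv)
    next
      assume 2: "length xs = 2"
      then obtain a b where "xs = [a, b]" by (auto simp: length_Suc_conv numeral_2_eq_2)
      then show False using xs(3,4) xs(5)[of 0] by auto
    qed
  qed
  have "set xs \<subseteq> V"
  proof
    fix z assume "z \<in> set xs"
    then obtain i where i: "i < length xs" "z = xs ! i" by (auto simp: in_set_conv_nth)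
    show "z \<in> V"
    proof (cases "Suc i < length xs")
      case True then show ?thesis using xs(5) edgeD(1) i by blast
    next
      case False
      then have "z = y" using i xs(1,4) by (metis Suc_lessI diff_Suc_1 last_conv_nth)
      then show ?thesis using edgeD[OF e] by simp
    qed
  qed
  then show ?thesis using xs len e edgeD[OF e] unfolding is_cycle_def
    by (intro exI[of _ xs]) auto
qed

text \<open>Along a geodesic from \<open>y\<close> to \<open>w\<close> every later vertex is
  strictly closer to \<open>w\<close> than \<open>y\<close>, hence closer than \<open>x\<close>, and
  so differs from \<open>x\<close>.\<close>

lemma walk_avoiding:
  assumes "y \<in> V" "w \<in> V" "x \<noteq> y" "d y w \<le> d x w"
  shows "walk_len {e \<in> E. x \<notin> e} y w (d y w)"
  using assms
proof (induction "d y w" arbitrary: y)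
  case 0
  then show ?case using dist_eq_0_iff by fastforce
next
  case (Suc n)
  have "y \<noteq> w" using Suc.hyps(2) by auto
  then obtain z where z: "{y, z} \<in> E" "d y w = Suc (d z w)"
    using ex_closer Suc.prems by metis
  have "x \<noteq> z" using z Suc.prems by auto
  then have "walk_len {e \<in> E. x \<notin> e} z w (d z w)"
    using Suc z edgeD[OF z(1)] by (intro Suc.hyps) auto
  then show ?case using z \<open>x \<noteq> z\<close> Suc.prems by (auto simp: walk_len_Suc)
qed

text \<open>A geodesic leaving the leaf \<open>a\<close> has to start with the edge to its only
  neighbour \<open>p\<close>.\<close>

lemma leaf_dist:
  assumes "leaf a" "{a, p} \<in> E" "x \<in> V" "x \<noteq> a"
  shows "d a x = Suc (d p x)"
  using assms ex_closer[of a x] edgeD[OF assms(2)] unfolding leaf_def by metis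

end

section \<open>The upper bound\<close>

locale girth7_graph = connected_graph +
  assumes card_V: "card V \<ge> 2" and girth: "girth V E \<ge> 7"
begin

section \<open>Exclusion of short cycles\<close>

lemma cycle_length:
  assumes "is_cycle V E cs"
  shows "7 \<le> length cs"
proof -
  have "girth V E \<le> enat (length cs)"
    unfolding girth_def using assms by (intro Inf_lower) auto
  then have "7 \<le> enat (length cs)" using girth by (rule order.trans[rotated])
  then show ?thesis by (simp add: numeral_eq_enat)
qed

text \<open>Stated with \<open>successively\<close> so that the adjacency conditions of an explicit
  list unfold by simplification. That the vertices lie in \<open>V\<close> follows from the
  edges.\<close>

lemma no_short_cycle:
  assumes "length cs \<ge> 3" "length cs < 7" "distinct cs" "{last cs, hd cs} \<in> E"
    "successively (\<lambda>x y. {x, y} \<in> E) cs"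
  shows False
proof -
  have "z \<in> V" if z: "z \<in> set cs" for z
  proof -
    obtain i where i: "i < length cs" "z = cs ! i" using z by (auto simp: in_set_conv_nth)
    show ?thesis
    proof (cases "Suc i < length cs")
      case True
      then have "{cs ! i, cs ! Suc i} \<in> E" using assms(5) by (simp add: successively_conv_nth)
      then show ?thesis using edgeD(1) i by blast
    next
      case False
      then have "i = length cs - 1" using i by linarith
      then have "z = last cs" using i by (metis last_conv_nth length_0_conv not_less_zero)
      then show ?thesis using edgeD(1)[OF assms(4)] by simp
    qed
  qed
  then have "is_cycle V E cs"
    using assms unfolding is_cycle_def successively_conv_nth by blast
  then show False using cycle_length assms(2) by fastforce
qed

lemma no_3_cycle: "{x, y} \<in> E \<Longrightarrow> {y, z} \<in> E \<Longrightarrow> {z, x} \<in> E \<Longrightarrow> False"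
  using no_short_cycle[of "[x, y, z]"] edgeD(3) by auto

lemma no_4_cycle:
  "{x, y} \<in> E \<Longrightarrow> {y, z} \<in> E \<Longrightarrow> {z, w} \<in> E \<Longrightarrow> {w, x} \<in> E \<Longrightarrow> x \<noteq> z \<Longrightarrow> y \<noteq> w \<Longrightarrow> False"
  using no_short_cycle[of "[x, y, z, w]"] edgeD(3) by auto

lemma edge_eqI: "e \<in> E \<Longrightarrow> x \<in> e \<Longrightarrow> y \<in> e \<Longrightarrow> x \<noteq> y \<Longrightarrow> e = {x, y}"
  by (erule edgeE) auto

text \<open>If other edges of the cover met both ends of \<open>e\<close>, then
  \<open>C - {e}\<close> would be a smaller cover.\<close>

lemma min_edge_cover_private_end:
  assumes C: "edge_cover V E C" "card C = edge_cover_number V E" and e: "e \<in> C"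
  shows "\<exists>x\<in>e. \<forall>e'\<in>C. x \<in> e' \<longrightarrow> e' = e"
proof (rule ccontr)
  assume n: "\<not> ?thesis"
  have "edge_cover V E (C - {e})"
    unfolding edge_cover_def
  proof (intro conjI ballI)
    show "C - {e} \<subseteq> E" using C by (auto simp: edge_cover_def)
    fix v assume "v \<in> V"
    then obtain e' where "e' \<in> C" "v \<in> e'" using C by (auto simp: edge_cover_def)
    then show "\<exists>e\<in>C - {e}. v \<in> e" using n by (cases "e' = e") auto
  qed
  from edge_cover_number_le[OF this] C e show False
    using finite_subset[OF _ finite_E] card_Diff1_less[of C e] by (auto simp: edge_cover_def)
qed

text \<open>Equal distances would make both \<open>x\<close> and \<open>y\<close> common neighbours
  of \<open>u\<close> and \<open>v\<close>, which is a 4-cycle. It is applied to cover partners of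
  \<open>u\<close> and \<open>v\<close> that lie in the resolving set.\<close>

lemma two_pendants_resolve:
  assumes "{u, x} \<in> E" "{v, y} \<in> E" "u \<noteq> v" "x \<noteq> y" "d u x = d v x" "d u y = d v y"
  shows False
proof -
  note V = edgeD[OF assms(1)] edgeD[OF assms(2)]
  have "d v x = 1" "d u y = 1" using dist_edge assms by auto
  then have "{v, x} \<in> E" "{u, y} \<in> E" using V dist_eq_1_iff[of v x] dist_eq_1_iff[of u y] by simp_all
  then show False using no_4_cycle[of u x v y] assms edgeD(4) by blast
qed

lemma nl_dim_bound: "nl_dim V E \<le> edge_cover_number V E - 1"
proof -
  obtain C where C: "edge_cover V E C" "card C = edge_cover_number V E"
    using ex_min_edge_cover[OF card_V] .
  have CE: "C \<subseteq> E" and cov: "\<And>v. v \<in> V \<Longrightarrow> \<exists>e\<in>C. v \<in> e"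
    using C by (auto simp: edge_cover_def)
  have finC: "finite C" using CE finite_E finite_subset by blast
  have "V \<noteq> {}" using card_V by auto
  then have "C \<noteq> {}" using cov by blast
  \<comment> \<open>Both cases choose one end of every cover edge except a single edge
    \<open>e\<close>; injectivity makes the set have exactly \<open>card C - 1\<close>
    elements.\<close>
  have goal: ?thesis if e: "e \<in> C"
    and inj: "inj_on g (C - {e})" and nr: "nonlocal_resolving V E (g ` (C - {e}))" for e g
    using nl_dim_le[OF nr] card_image[OF inj] C e finC by simp
  show ?thesis
  proof (cases "\<exists>e1\<in>C. \<exists>e2\<in>C. e1 \<noteq> e2 \<and> e1 \<inter> e2 \<noteq> {}")
    case True
    then obtain e1 e2 c where e12: "e1 \<in> C" "e2 \<in> C" "e1 \<noteq> e2" "c \<in> e1" "c \<in> e2" by blast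
    obtain f where f: "\<And>e. e \<in> C \<Longrightarrow> f e \<in> e" "\<And>e e'. e \<in> C \<Longrightarrow> e' \<in> C \<Longrightarrow> f e \<in> e' \<Longrightarrow> e' = e"
      using bchoice[of C "\<lambda>e x. x \<in> e \<and> (\<forall>e'\<in>C. x \<in> e' \<longrightarrow> e' = e)"]
        min_edge_cover_private_end[OF C] by blast
    have inj: "inj_on f C" using f by (metis inj_onI)
    \<comment> \<open>Of the two cover edges \<open>{c, a}\<close> and \<open>{c, b}\<close> meeting
      in \<open>c\<close>, the first loses its private end \<open>a\<close>; the vertex
      \<open>b\<close> stays in \<open>X\<close> and serves \<open>c\<close>.\<close>
    define X where "X = f ` (C - {e1})"
    define a where "a = f e1"
    define b where "b = f e2"
    have "a \<noteq> c" "b \<noteq> c" using f(2) e12 unfolding a_def b_def by blast+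
    have e1: "e1 = {c, a}" and e2: "e2 = {c, b}"
      using edge_eqI[of e1 c a] edge_eqI[of e2 c b] e12 CE f(1) \<open>a \<noteq> c\<close> \<open>b \<noteq> c\<close>
      unfolding a_def b_def by blast+
    have "b \<in> X" using e12 unfolding X_def b_def by auto
    have "a \<notin> X" using e12 inj unfolding X_def a_def inj_on_def by auto
    have XV: "X \<subseteq> V"
    proof
      fix x assume "x \<in> X"
      then obtain e where "e \<in> E" "x \<in> e" using f(1) CE unfolding X_def by blast
      then show "x \<in> V" by (auto elim: edgeE)
    qed
    \<comment> \<open>The partner is the private end of a cover edge through \<open>v\<close>. If
      that edge is \<open>e1\<close>, then \<open>v = c\<close> and \<open>e2\<close> supplies the
      partner \<open>b\<close> instead.\<close>
    have pend: "\<exists>y\<in>X. {v, y} \<in> C \<and> (\<forall>e\<in>C. y \<in> e \<longrightarrow> e = {v, y})" if v: "v \<in> V" "v \<notin> X" "v \<noteq> a" for v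
    proof -
      obtain e where e: "e \<in> C" "v \<in> e" using cov v by blast
      show ?thesis
      proof (cases "e = e1")
        case True
        then have "v = c" using e e1 v by auto
        then show ?thesis
          using e2 e12(2) f(2)[OF e12(2)] \<open>b \<in> X\<close> by (intro bexI[of _ b]) (auto simp: b_def)
      next
        case False
        then have fX: "f e \<in> X" using e unfolding X_def by blast
        then have "v \<noteq> f e" using v by auto
        then have "{v, f e} = e" using edge_eqI[of e v "f e"] e f(1) CE by blast
        then show ?thesis using fX e(1) f(2)[OF e(1)] by (intro bexI[of _ "f e"]) auto
      qed
    qed
    have ca: "{c, a} \<in> E" and cb: "{c, b} \<in> E" using e1 e2 e12 CE by auto
    have "a \<noteq> b" using e1 e2 e12 by auto
    have dab: "d a b = 2"
    proof -
      have "d a b \<noteq> 0" using dist_eq_0_iff[of a b] edgeD[OF ca] edgeD[OF cb] \<open>a \<noteq> b\<close> by simp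
      moreover have "d a b \<noteq> 1"
        using dist_eq_1_iff[of a b] no_3_cycle[of a b c] edgeD[OF ca] edgeD[OF cb] ca by auto
      moreover have "d a b \<le> 2"
        using dist_edge_le[of a c b] dist_edge[OF cb] edgeD[OF ca] edgeD[OF cb] by simp
      ultimately show ?thesis by linarith
    qed
    \<comment> \<open>The partner \<open>y\<close> of \<open>v\<close> is adjacent to
      \<open>a\<close>, and since \<open>b\<close> does not resolve the pair, \<open>v\<close> has
      distance 2 from \<open>b\<close> through some \<open>w\<close>. This gives the 6-cycle
      \<open>v, y, a, c, b, w\<close>; the coincidences \<open>w = c\<close> and
      \<open>w = y\<close> give 4-cycles.\<close>
    have no_a: False if v: "v \<in> V" "v \<notin> X" "v \<noteq> a" "{a, v} \<notin> E"
      and eq: "\<And>x. x \<in> X \<Longrightarrow> d a x = d v x" for v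
    proof -
      obtain y where y: "y \<in> X" "{v, y} \<in> C" "\<And>e. e \<in> C \<Longrightarrow> y \<in> e \<Longrightarrow> e = {v, y}"
        using pend[OF v(1-3)] by blast
      have vy: "{v, y} \<in> E" using y(2) CE by auto
      have "d a y = 1" using eq[OF y(1)] dist_edge[OF vy] by simp
      then have ay: "{a, y} \<in> E" using dist_eq_1_iff[of a y] edgeD[OF vy] edgeD[OF ca] by simp
      have "d v b = 2" using eq \<open>b \<in> X\<close> dab by simp
      then obtain w where w: "{v, w} \<in> E" "{w, b} \<in> E"
        using dist_eq_2D v edgeD[OF cb] by metis
      have "v \<noteq> c" using v ca by (auto simp: insert_commute)
      have "y \<noteq> c" using y(3)[OF e12(1)] y(3)[OF e12(2)] e12(3-5) by blast
      have "y \<noteq> b"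
      proof
        assume "y = b"
        then have "e2 = {v, y}" using y(3) e12(2) e2 by blast
        then show False using e2 \<open>v \<noteq> c\<close> \<open>y = b\<close> by (auto simp: doubleton_eq_iff)
      qed
      have "w \<noteq> c"
        using no_4_cycle[of v y a c] vy edgeD(4)[OF ay] edgeD(4)[OF ca] edgeD(4)[OF w(1)] v(3) \<open>y \<noteq> c\<close> by auto
      have "w \<noteq> y"
        using no_4_cycle[of y a c b] edgeD(4)[OF ay] edgeD(4)[OF ca] cb edgeD(4)[OF w(2)] \<open>y \<noteq> c\<close> \<open>a \<noteq> b\<close> by auto
      have "w \<noteq> a" using v(4) edgeD(4)[OF w(1)] by auto
      have "v \<noteq> b" using v \<open>b \<in> X\<close> by auto
      show False
        using no_short_cycle[of "[v, y, a, c, b, w]"] edgeD(3)[OF vy] edgeD(3)[OF ay] edgeD(3)[OF ca]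
          edgeD(3)[OF cb] edgeD(3)[OF w(1)] edgeD(3)[OF w(2)] vy edgeD(4)[OF ay] edgeD(4)[OF ca] cb
          edgeD(4)[OF w(1)] edgeD(4)[OF w(2)]
          v(3) \<open>v \<noteq> c\<close> \<open>v \<noteq> b\<close> \<open>y \<noteq> c\<close> \<open>y \<noteq> b\<close> \<open>w \<noteq> c\<close> \<open>w \<noteq> y\<close> \<open>w \<noteq> a\<close> \<open>a \<noteq> b\<close> by auto
    qed
    have "nonlocal_resolving V E X"
    proof (rule nonlocal_resolvingI[OF XV])
      fix u v
      assume uv: "u \<in> V" "v \<in> V" "u \<noteq> v" "{u, v} \<notin> E" "u \<notin> X" "v \<notin> X"
        and eq: "\<And>x. x \<in> X \<Longrightarrow> d u x = d v x"
      show False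
      proof (cases "u = a \<or> v = a")
        case True
        then show False using no_a[of v] no_a[of u] uv eq by (auto simp: insert_commute)
      next
        case False
        then obtain y where y: "y \<in> X" "{u, y} \<in> C" "\<forall>e\<in>C. y \<in> e \<longrightarrow> e = {u, y}"
          using pend[of u] uv by blast
        obtain y' where y': "y' \<in> X" "{v, y'} \<in> C" using pend[of v] False uv by blast
        \<comment> \<open>The partner \<open>y\<close> lies on one cover edge only, so it cannot
          serve both \<open>u\<close> and \<open>v\<close>.\<close>
        have "y \<noteq> y'"
        proof
          assume "y = y'"
          then have "{v, y} = {u, y}" using y(3) y'(2) by simp
          then show False using uv(3) by (auto simp: doubleton_eq_iff)
        qed
        moreover have "{u, y} \<in> E" "{v, y'} \<in> E" using y(2) y'(2) CE by auto
        ultimately show False using two_pendants_resolve uv(3) eq y(1) y'(1) by blast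
      qed
    qed
    then show ?thesis
      using goal[of e1 f] e12 inj unfolding X_def by (blast intro: inj_on_subset)
  next
    case False
    then have disj: "\<And>e e' x. e \<in> C \<Longrightarrow> e' \<in> C \<Longrightarrow> x \<in> e \<Longrightarrow> x \<in> e' \<Longrightarrow> e = e'" by blast
    obtain e0 where e0: "e0 \<in> C" using \<open>C \<noteq> {}\<close> by blast
    then obtain c l where cl: "e0 = {c, l}" using CE by (blast elim: edgeE)
    then have clE: "{c, l} \<in> E" using e0 CE by auto
    \<comment> \<open>If both ends of \<open>e\<close> had a neighbour in \<open>{c, l}\<close>, a
      common neighbour would close a 3-cycle and different ones a 4-cycle through
      \<open>{c, l}\<close>.\<close>
    have "\<exists>x\<in>e. {x, c} \<notin> E \<and> {x, l} \<notin> E" if e: "e \<in> C - {e0}" for e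
    proof (rule ccontr)
      assume n: "\<not> ?thesis"
      obtain x y where xy: "e = {x, y}" using e CE by (blast elim: edgeE)
      then have xyE: "{x, y} \<in> E" using e CE by auto
      have ne: "x \<noteq> c" "x \<noteq> l" "y \<noteq> c" "y \<noteq> l" using disj[OF e0, of e] e xy cl by auto
      have "{x, c} \<in> E \<or> {x, l} \<in> E" "{y, c} \<in> E \<or> {y, l} \<in> E" using n xy by auto
      then show False
        using no_3_cycle[of x y c] no_3_cycle[of x y l] no_4_cycle[of x c l y] no_4_cycle[of x l c y]
          xyE clE ne by (auto simp: insert_commute)
    qed
    then have "\<forall>e\<in>C - {e0}. \<exists>x. x \<in> e \<and> {x, c} \<notin> E \<and> {x, l} \<notin> E" by blast
    from bchoice[OF this] obtain g
      where g: "\<And>e. e \<in> C - {e0} \<Longrightarrow> g e \<in> e \<and> {g e, c} \<notin> E \<and> {g e, l} \<notin> E" by blast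
    define X where "X = g ` (C - {e0})"
    have inj: "inj_on g (C - {e0})"
    proof (rule inj_onI)
      fix e e' assume e: "e \<in> C - {e0}" "e' \<in> C - {e0}" "g e = g e'"
      have "g e \<in> e" "g e \<in> e'" using g[OF e(1)] g[OF e(2)] e(3) by simp_all
      then show "e = e'" using disj[of e e' "g e"] e by blast
    qed
    have XV: "X \<subseteq> V"
    proof
      fix x assume "x \<in> X"
      then obtain e where "e \<in> E" "x \<in> e" using g CE unfolding X_def by blast
      then show "x \<in> V" by (auto elim: edgeE)
    qed
    have pend: "\<exists>y\<in>X. {v, y} \<in> C \<and> (\<forall>e\<in>C. y \<in> e \<longrightarrow> e = {v, y})" if v: "v \<in> V" "v \<notin> X" "v \<notin> {c, l}" for v
    proof -
      obtain e where e: "e \<in> C" "v \<in> e" using cov v by blast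
      then have "e \<noteq> e0" using v cl by auto
      then have gX: "g e \<in> X" using e unfolding X_def by blast
      then have "v \<noteq> g e" using v by auto
      moreover have ge: "g e \<in> e" using g e(1) \<open>e \<noteq> e0\<close> by blast
      ultimately have "{v, g e} = e" using edge_eqI[of e v "g e"] e CE by blast
      then show ?thesis using gX e(1) ge disj[OF e(1)] by (intro bexI[of _ "g e"]) auto
    qed
    \<comment> \<open>The partner \<open>y\<close> of \<open>v\<close> would have to be adjacent to
      \<open>u\<close>, but by the choice of \<open>g\<close> no vertex of \<open>X\<close> is
      adjacent to \<open>c\<close> or \<open>l\<close>.\<close>
    have no_cl: False if u: "u \<in> {c, l}" and v: "v \<in> V" "v \<notin> X" "u \<noteq> v" "{u, v} \<notin> E"
      and eq: "\<And>x. x \<in> X \<Longrightarrow> d u x = d v x" for u v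
    proof -
      have "v \<notin> {c, l}" using u v clE edgeD(4)[OF clE] by auto
      then obtain y where y: "y \<in> X" "{v, y} \<in> C" using pend[of v] v by blast
      then have vy: "{v, y} \<in> E" using CE by auto
      have "d u y = 1" using eq[OF y(1)] dist_edge[OF vy] by simp
      moreover have "u \<in> V" using u edgeD[OF clE] by auto
      ultimately have "{u, y} \<in> E" using dist_eq_1_iff[of u y] edgeD[OF vy] by simp
      then have "{y, u} \<in> E" by (rule edgeD)
      moreover have "{y, c} \<notin> E" "{y, l} \<notin> E" using y(1) g unfolding X_def by auto
      ultimately show False using u by auto
    qed
    have "nonlocal_resolving V E X"
    proof (rule nonlocal_resolvingI[OF XV])
      fix u v
      assume uv: "u \<in> V" "v \<in> V" "u \<noteq> v" "{u, v} \<notin> E" "u \<notin> X" "v \<notin> X"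
        and eq: "\<And>x. x \<in> X \<Longrightarrow> d u x = d v x"
      show False
      proof (cases "u \<in> {c, l} \<or> v \<in> {c, l}")
        case True
        have "{v, u} \<notin> E" using uv edgeD(4) by blast
        then show False using True no_cl[of u v] no_cl[of v u] uv eq by auto
      next
        case False
        then obtain y where y: "y \<in> X" "{u, y} \<in> C" "\<forall>e\<in>C. y \<in> e \<longrightarrow> e = {u, y}"
          using pend[of u] uv by blast
        obtain y' where y': "y' \<in> X" "{v, y'} \<in> C" using pend[of v] False uv by blast
        have "y \<noteq> y'"
        proof
          assume "y = y'"
          then have "{v, y} = {u, y}" using y(3) y'(2) by simp
          then show False using uv(3) by (auto simp: doubleton_eq_iff)
        qed
        moreover have "{u, y} \<in> E" "{v, y'} \<in> E" using y(2) y'(2) CE by auto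
        ultimately show False using two_pendants_resolve uv(3) eq y(1) y'(1) by blast
      qed
    qed
    then show ?thesis
      using goal[of e0 g] e0 inj unfolding X_def by blast
  qed
qed

end

section \<open>Trees\<close>

locale tree_graph = connected_graph +
  assumes acyclic: "\<not> is_cycle V E cs"
begin

text \<open>At most one neighbour of \<open>x\<close> fails to be farther from \<open>w\<close> than
  \<open>x\<close>: for two such neighbours, geodesics to \<open>w\<close> avoid \<open>x\<close>
  and join up to a walk between them, which closes to a cycle through \<open>x\<close>.\<close>

lemma farther:
  assumes "{x, y} \<in> E" "{x, z} \<in> E" "y \<noteq> z" "w \<in> V" "d y w \<le> d x w"
  shows "d z w = Suc (d x w)"
proof (rule ccontr)
  assume n: "d z w \<noteq> Suc (d x w)"
  note V = edgeD[OF assms(1)] edgeD[OF assms(2)]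
  let ?F = "{e \<in> E. x \<notin> e}"
  have "d z w \<le> d x w" using dist_edge_le[of z x w] V assms(4) n by simp
  then have "walk_len ?F z w (d z w)" using walk_avoiding V assms by auto
  moreover have "walk_len ?F w y (d y w)" using walk_avoiding[THEN walk_len_sym] V assms by auto
  ultimately have "walk_len ?F z y (d z w + d y w)" by (rule walk_len_trans)
  then have "walk_len (E - {{x, y}}) z y (d z w + d y w)" by (rule walk_len_mono) auto
  moreover have "{x, z} \<in> E - {{x, y}}" using assms(2,3) by (auto simp: doubleton_eq_iff)
  ultimately have "walk_len (E - {{x, y}}) x y (Suc (d z w + d y w))"
    unfolding walk_len_Suc by blast
  from cycle_from_walk[OF assms(1) this] show False using acyclic by blast
qed

text \<open>The vertices that have \<open>u\<close> on a geodesic to \<open>w\<close>: the part of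
  the tree hidden by \<open>u\<close> when viewed from \<open>w\<close>, with \<open>u\<close>
  itself included.\<close>

definition behind :: "'a \<Rightarrow> 'a \<Rightarrow> 'a set" where
  "behind w u = {x \<in> V. d x w = d x u + d u w}"

lemma leaf_in_V: "leaf x \<Longrightarrow> x \<in> V"
  unfolding leaf_def using edgeD(1) by blast

text \<open>The triangle inequality through \<open>u\<close> forces
  \<open>d z u = Suc (d x u)\<close>, so a step away from \<open>w\<close> is also a step away from
  \<open>u\<close>.\<close>

lemma behind_step:
  assumes "x \<in> behind w u" "{x, z} \<in> E" "d z w = Suc (d x w)" "u \<in> V" "w \<in> V"
  shows "z \<in> behind w u"
proof -
  have "d z u \<le> Suc (d x u)" using dist_edge_le edgeD[OF assms(2)] assms(4) by blast
  moreover have "d z w \<le> d z u + d u w" using dist_triangle edgeD[OF assms(2)] assms(4,5) by blast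
  ultimately show ?thesis using assms edgeD[OF assms(2)] unfolding behind_def by auto
qed

text \<open>Take a vertex behind \<open>u\<close> farthest from \<open>w\<close>. A neighbour other
  than the one towards \<open>w\<close> would be farther and still behind \<open>u\<close>, so there
  is none.\<close>

lemma ex_leaf_behind:
  assumes "u \<in> V" "w \<in> V" "u \<noteq> w"
  obtains x where "x \<in> behind w u" "leaf x"
proof -
  let ?B = "behind w u"
  have "finite ?B" using finite_V by (auto simp: behind_def)
  moreover have uB: "u \<in> ?B" using assms by (simp add: behind_def)
  ultimately have "Max ((\<lambda>x. d x w) ` ?B) \<in> (\<lambda>x. d x w) ` ?B" by (intro Max_in) auto
  then obtain x where x: "x \<in> ?B" "Max ((\<lambda>x. d x w) ` ?B) = d x w" by blast
  have mx: "d z w \<le> d x w" if "z \<in> ?B" for z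
    using that \<open>finite ?B\<close> unfolding x(2)[symmetric] by (intro Max_ge) auto
  have "x \<in> V" using x by (simp add: behind_def)
  have "d u w \<noteq> 0" using dist_eq_0_iff assms by blast
  then have "x \<noteq> w" using mx[OF uB] by auto
  then obtain y where y: "{x, y} \<in> E" "d x w = Suc (d y w)" using ex_closer \<open>x \<in> V\<close> assms by metis
  have "z = y" if z: "{x, z} \<in> E" for z
  proof (rule ccontr)
    assume "z \<noteq> y"
    then have "d z w = Suc (d x w)" using farther[OF y(1) z] y(2) assms by simp
    then show False using mx[OF behind_step[OF x(1) z]] assms by simp
  qed
  then have "leaf x" unfolding leaf_def using y by blast
  with x(1) that show thesis by blast
qed

text \<open>Adding the two defining equations for a common element gives
  \<open>d u w = 0\<close>.\<close>

lemma behind_disjoint: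
  assumes "u \<in> V" "w \<in> V" "u \<noteq> w"
  shows "behind w u \<inter> behind u w = {}"
  using assms dist_eq_0_iff[of u w] by (auto simp: behind_def dist_commute[of E w u])

lemma behind_resolves:
  assumes "u \<in> V" "w \<in> V" "u \<noteq> w" "x \<in> behind w u"
  shows "d u x \<noteq> d w x"
  using assms dist_eq_0_iff[of u w] by (auto simp: behind_def dist_commute[of E _ x])

section \<open>Resolving a tree by its leaves\<close>

lemma finite_leaves: "finite leaves"
  using finite_subset[OF _ finite_V, of leaves] leaf_in_V by (auto simp: leaves_def)

text \<open>The leaves found behind \<open>u\<close> and behind \<open>v\<close> are different and
  both resolve the pair; at most one of them is \<open>a\<close>.\<close>

lemma leaves_minus_one_resolving: "nonlocal_resolving V E (leaves - {a})"
proof (rule nonlocal_resolvingI)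
  show "leaves - {a} \<subseteq> V" using leaf_in_V by (auto simp: leaves_def)
  fix u v assume uv: "u \<in> V" "v \<in> V" "u \<noteq> v"
    and eq: "\<And>x. x \<in> leaves - {a} \<Longrightarrow> d u x = d v x"
  obtain x where x: "x \<in> behind v u" "leaf x" using ex_leaf_behind uv by metis
  obtain y where y: "y \<in> behind u v" "leaf y" using ex_leaf_behind uv by metis
  have "x \<noteq> y" using behind_disjoint uv x y by blast
  moreover have "x = a" using behind_resolves[of u v x] eq[of x] uv x by (auto simp: leaves_def)
  moreover have "y = a" using behind_resolves[of v u y] eq[of y] uv y by (auto simp: leaves_def)
  ultimately show False by simp
qed

text \<open>The pendant leaf of an inner vertex behind \<open>u\<close> is again behind
  \<open>u\<close>, hence it is \<open>a\<close> and the vertex is \<open>p\<close>. The step away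
  from \<open>w\<close> fails only if that leaf is \<open>w\<close>, which would make
  \<open>u\<close> and \<open>w\<close> adjacent.\<close>

lemma behind_subset:
  assumes pend: "\<And>x. x \<in> V \<Longrightarrow> \<not> leaf x \<Longrightarrow> \<exists>l. leaf l \<and> {x, l} \<in> E"
    and uw: "u \<in> V" "w \<in> V" "u \<noteq> w" "{u, w} \<notin> E"
    and a: "leaf a" "{a, p} \<in> E" "\<And>x. x \<in> behind w u \<Longrightarrow> leaf x \<Longrightarrow> x = a"
  shows "behind w u \<subseteq> {a, p}"
proof
  fix x assume x: "x \<in> behind w u"
  show "x \<in> {a, p}"
  proof (cases "leaf x")
    case True
    then show ?thesis using a x by blast
  next
    case False
    have "x \<in> V" using x by (simp add: behind_def)
    then obtain l where l: "leaf l" "{x, l} \<in> E" using pend False by blast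
    have "l \<noteq> w"
    proof
      assume "l = w"
      then have "d x w = 1" using dist_edge l by simp
      moreover have "d u w \<noteq> 0" using dist_eq_0_iff uw by blast
      ultimately have "d x u = 0" using x unfolding behind_def by auto
      then have "x = u" using dist_eq_0_iff \<open>x \<in> V\<close> uw by blast
      then show False using l uw \<open>l = w\<close> by simp
    qed
    then have "d l w = Suc (d x w)" using leaf_dist[of l x w] l uw edgeD(4) by blast
    then have "l \<in> behind w u" using behind_step x l uw by blast
    then have "{a, x} \<in> E" using a l edgeD(4) by blast
    then show ?thesis using a unfolding leaf_def by blast
  qed
qed

text \<open>Removing pendant leaves \<open>a\<close> of \<open>p\<close> and \<open>b\<close> of
  \<open>q\<close> leaves a pair unresolved, with \<open>a\<close> the only leaf behind one vertex
  and \<open>b\<close> the only leaf behind the other. A further branch at \<open>q\<close> shows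
  that this pair is \<open>p\<close> and \<open>b\<close>. The assumption \<open>branching\<close>
  says, without cardinalities, that the degree of \<open>q\<close> is neither 1 nor 2.\<close>

lemma inner_vertex_adjacent_to_branching:
  assumes pend: "\<And>x. x \<in> V \<Longrightarrow> \<not> leaf x \<Longrightarrow> \<exists>l. leaf l \<and> {x, l} \<in> E"
    and nonres: "\<And>a b. leaf a \<Longrightarrow> leaf b \<Longrightarrow> a \<noteq> b \<Longrightarrow> \<not> nonlocal_resolving V E (leaves - {a, b})"
    and pq: "p \<in> V" "q \<in> V" "p \<noteq> q" "\<not> leaf p" "\<not> leaf q"
    and branching: "\<And>y z. {y'. {q, y'} \<in> E} \<noteq> {y, z}"
  shows "\<exists>l. leaf l \<and> {y. {p, y} \<in> E} = {q, l}"
proof -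
  obtain a where a: "leaf a" "{p, a} \<in> E" using pend pq by blast
  obtain b where b: "leaf b" "{q, b} \<in> E" using pend pq by blast
  have a': "{a, p} \<in> E" and b': "{b, q} \<in> E" using a b edgeD(4) by auto
  have aq: "{a, q} \<notin> E" and bp: "{b, p} \<notin> E" using a a' b b' pq unfolding leaf_def by blast+
  have "a \<noteq> b" using aq b' by auto
  note VV = edgeD(1)[OF a'] edgeD(1)[OF b']
  obtain y where y: "{q, y} \<in> E" "d q p = Suc (d y p)" using ex_closer pq by metis
  \<comment> \<open>The branch through \<open>z\<close> leads away from \<open>p\<close> and is not
    the pendant edge to \<open>b\<close>.\<close>
  have "\<exists>z. {q, z} \<in> E \<and> z \<noteq> y \<and> z \<noteq> b" using branching[of y b] y b by auto
  then obtain z where z: "{q, z} \<in> E" "z \<noteq> y" "z \<noteq> b" by blast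
  have "z \<in> V" using edgeD z by blast
  have dz: "d z p = Suc (d q p)" using farther[OF y(1) z(1)] z(2) y(2) pq by simp
  then have "z \<noteq> p" by auto
  \<comment> \<open>This leaf differs from \<open>a\<close> and \<open>b\<close>, so it stays in the
    reduced set, and \<open>q\<close> lies on the geodesic from it to \<open>p\<close>.\<close>
  then obtain x where x: "x \<in> behind p z" "leaf x" using ex_leaf_behind \<open>z \<in> V\<close> pq by metis
  have "x \<in> V" using x by (simp add: behind_def)
  have xp: "d x p = d x z + Suc (d q p)" using x dz by (simp add: behind_def)
  have "d x q \<le> Suc (d x z)"
    using dist_edge_le[OF z(1) \<open>x \<in> V\<close>] by (simp add: dist_commute[of E _ x])
  moreover have "d x p \<le> d x q + d q p" using dist_triangle \<open>x \<in> V\<close> pq by blast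
  ultimately have xq: "d x q = Suc (d x z)" "d x p = d x q + d q p" using xp by auto
  have "d q p \<noteq> 0" using dist_eq_0_iff pq by blast
  have "x \<noteq> b"
  proof
    assume "x = b"
    then have "d x z = 0" using xq(1) dist_edge[OF b'] by simp
    then show False using dist_eq_0_iff \<open>x \<in> V\<close> \<open>z \<in> V\<close> z \<open>x = b\<close> by blast
  qed
  have "x \<noteq> a" using xp dist_edge[OF a'] \<open>d q p \<noteq> 0\<close> by auto
  have "z \<noteq> a" using aq z edgeD(4) by blast
  have ax: "d a x = Suc (d p x)" using leaf_dist a(1) a' \<open>x \<in> V\<close> \<open>x \<noteq> a\<close> by blast
  have bx: "d b x = Suc (d q x)" using leaf_dist b(1) b' \<open>x \<in> V\<close> \<open>x \<noteq> b\<close> by blast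

  \<comment> \<open>The pair is oriented so that \<open>a\<close> is behind \<open>u\<close> and
    \<open>b\<close> behind \<open>w\<close>; the opposite assignment is reduced to this one by
    swapping.\<close>
  have key: "\<exists>l. leaf l \<and> {y. {p, y} \<in> E} = {q, l}"
    if uw: "u \<in> V" "w \<in> V" "u \<noteq> w" "{u, w} \<notin> E"
      and eq: "\<And>x. x \<in> leaves - {a, b} \<Longrightarrow> d u x = d w x"
      and bu: "\<And>x. x \<in> behind w u \<Longrightarrow> leaf x \<Longrightarrow> x = a"
      and bw: "\<And>x. x \<in> behind u w \<Longrightarrow> leaf x \<Longrightarrow> x = b" for u w
  proof -
    have Bu: "behind w u \<subseteq> {a, p}" using behind_subset[OF pend uw a(1) a' bu] by blast
    have wu: "w \<noteq> u" "{w, u} \<notin> E" using uw edgeD(4) by auto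
    have Bw: "behind u w \<subseteq> {b, q}" using behind_subset[OF pend uw(2,1) wu b(1) b' bw] by blast
    have u: "u = a \<or> u = p" using Bu uw by (auto simp: behind_def)
    have w: "w = b \<or> w = q" using Bw uw by (auto simp: behind_def)
    \<comment> \<open>Otherwise the branch vertex \<open>z\<close> would be behind \<open>q\<close>
      as well, although only \<open>b\<close> and \<open>q\<close> can be.\<close>
    have "w \<noteq> q"
    proof
      assume "w = q"
      have "d z u = Suc (d q u)"
      proof (cases "u = p")
        case False
        then have "u = a" using u by simp
        moreover have "q \<noteq> a" using pq a by auto
        ultimately show ?thesis
          using leaf_dist[OF a(1) a', of z] leaf_dist[OF a(1) a', of q] \<open>z \<noteq> a\<close> \<open>z \<in> V\<close> pq dz
          by (simp add: dist_commute[of E a] dist_commute[of E p])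
      qed (use dz in simp)
      moreover have "q \<in> behind u q" using pq by (simp add: behind_def)
      ultimately have "z \<in> behind u q" using behind_step z uw pq by blast
      then have "z \<in> {b, q}" using Bw \<open>w = q\<close> by blast
      then show False using z edgeD(3)[OF z(1)] by auto
    qed
    then have "w = b" using w by simp
    \<comment> \<open>The leaf \<open>x\<close> does not resolve \<open>u\<close> and
      \<open>b\<close>, so \<open>u\<close> is one step farther from \<open>x\<close> than
      \<open>q\<close>. The vertex \<open>a\<close> is too far away for that, and for
      \<open>u = p\<close> it means that \<open>p\<close> and \<open>q\<close> are adjacent.\<close>
    then have ux: "d u x = Suc (d q x)"
      using eq[of x] x bx \<open>x \<noteq> a\<close> \<open>x \<noteq> b\<close> by (simp add: leaves_def)
    then have "u \<noteq> a"
      using ax xq(2) \<open>d q p \<noteq> 0\<close> by (auto simp: dist_commute[of E _ x])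
    then have "u = p" using u by simp
    then have "d q p = 1" using ux xq(2) by (simp add: dist_commute[of E _ x])
    then have qp: "{q, p} \<in> E" using dist_eq_1_iff pq by blast
    \<comment> \<open>A neighbour of \<open>p\<close> other than \<open>q\<close> is behind
      \<open>p\<close> as seen from \<open>b\<close>, and only \<open>a\<close> and \<open>p\<close>
      are there.\<close>
    have "y' = a" if y': "{p, y'} \<in> E" "y' \<noteq> q" for y'
    proof -
      have "d y' q = Suc (d p q)"
        using farther[OF edgeD(4)[OF qp] y'(1), of q] y'(2) pq by simp
      moreover have "y' \<noteq> b" using y' bp edgeD(4) by blast
      moreover have "p \<noteq> b" using pq b by auto
      ultimately have "d y' b = Suc (d p b)"
        using leaf_dist[OF b(1) b', of y'] leaf_dist[OF b(1) b', of p] edgeD[OF y'(1)]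
        by (simp add: dist_commute[of E b] dist_commute[of E q])
      moreover have "p \<in> behind b p" using pq by (simp add: behind_def)
      ultimately have "y' \<in> behind b p" using behind_step y' pq VV by blast
      then have "y' \<in> {a, p}" using Bu \<open>w = b\<close> \<open>u = p\<close> by blast
      then show ?thesis using edgeD(3)[OF y'(1)] by auto
    qed
    then have "{y. {p, y} \<in> E} = {q, a}" using a edgeD(4)[OF qp] by blast
    then show ?thesis using a by blast
  qed

  have "\<exists>u w. u \<in> V \<and> w \<in> V \<and> u \<noteq> w \<and> {u, w} \<notin> E \<and> (\<forall>x\<in>leaves - {a, b}. d u x = d w x)"
    using nonres[OF a(1) b(1) \<open>a \<noteq> b\<close>] leaf_in_V
    unfolding nonlocal_resolving_def by (auto simp: leaves_def)
  then obtain u w where uw: "u \<in> V" "w \<in> V" "u \<noteq> w" "{u, w} \<notin> E" 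
    and eq: "\<And>x. x \<in> leaves - {a, b} \<Longrightarrow> d u x = d w x" by blast
  have ab: "x = a \<or> x = b" if "x \<in> behind w u \<or> x \<in> behind u w" "leaf x" for x
  proof (rule ccontr)
    assume "\<not> ?thesis"
    then have "d u x = d w x" using eq that by (simp add: leaves_def)
    then show False using that behind_resolves[of u w x] behind_resolves[of w u x] uw by auto
  qed
  obtain s where s: "s \<in> behind w u" "leaf s" using ex_leaf_behind uw by metis
  obtain t where t: "t \<in> behind u w" "leaf t" using ex_leaf_behind uw by metis
  have st: "s' \<noteq> t'" if "s' \<in> behind w u" "t' \<in> behind u w" for s' t'
    using that behind_disjoint uw by blast
  have wu: "{w, u} \<notin> E" using uw edgeD(4) by blast
  show ?thesis
  proof (cases "s = a")
    case True
    then have "t = b" using ab[of t] st s t by blast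
    have "r = a" if "r \<in> behind w u" "leaf r" for r using ab[of r] st that t \<open>t = b\<close> by blast
    moreover have "r = b" if "r \<in> behind u w" "leaf r" for r using ab[of r] st that s True by blast
    ultimately show ?thesis using key[of u w] uw eq by blast
  next
    case False
    then have "s = b" using ab[of s] s by blast
    then have "t = a" using ab[of t] st s t by blast
    have "r = b" if "r \<in> behind w u" "leaf r" for r using ab[of r] st that t \<open>t = a\<close> by blast
    moreover have "r = a" if "r \<in> behind u w" "leaf r" for r using ab[of r] st that s \<open>s = b\<close> by blast
    ultimately show ?thesis using key[of w u] uw wu eq by (metis (no_types, lifting))
  qed
qed

end

section \<open>Subdivided stars\<close>

context connected_graph
begin

text \<open>Each of two adjacent leaves would be farther from the inner vertex \<open>c\<close> than
  the other.\<close>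

lemma no_adjacent_leaves:
  assumes "c \<in> V" "\<not> leaf c" "leaf l" "leaf l'"
  shows "{l, l'} \<notin> E"
proof
  assume e: "{l, l'} \<in> E"
  have "d l c = Suc (d l' c)" using leaf_dist[OF assms(3) e assms(1)] assms(2,3) by auto
  moreover have "d l' c = Suc (d l c)"
    using leaf_dist[OF assms(4) edgeD(4)[OF e] assms(1)] assms(2,4) by auto
  ultimately show False by simp
qed

text \<open>The star is recognised from the neighbourhoods of its inner vertices. Its leaf set is
  the set of leaves of the graph, which requires the centre to be an inner vertex.\<close>

lemma star_subdivisionI:
  assumes c: "c \<in> V" "\<not> leaf c" and l0: "leaf l0" "{c, l0} \<in> E"
    and inner: "\<And>q. q \<in> V \<Longrightarrow> \<not> leaf q \<Longrightarrow> q \<noteq> c \<Longrightarrow> \<exists>l. leaf l \<and> {y. {q, y} \<in> E} = {c, l}"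
  shows "star_subdivision V E"
proof -
  \<comment> \<open>The leaves not attached to \<open>c\<close> belong to the subdivided edges, and
    the only neighbour \<open>s l\<close> of such a leaf is the subdividing vertex.\<close>
  define S where "S = {l \<in> leaves. {c, l} \<notin> E}"
  define s where "s l = (THE y. {l, y} \<in> E)" for l
  have s: "{l, y} \<in> E \<longleftrightarrow> y = s l" if "leaf l" for l y
  proof -
    have ex1: "\<exists>!y. {l, y} \<in> E" using that by (simp add: leaf_def)
    show ?thesis using theI'[OF ex1] ex1 unfolding s_def by blast
  qed
  have sE: "{l, s l} \<in> E" if "leaf l" for l using s that by blast
  have leafS: "leaf l" if "l \<in> S" for l using that by (simp add: S_def leaves_def)
  have sS: "s l \<noteq> c \<and> \<not> leaf (s l) \<and> s l \<in> V \<and> {y. {s l, y} \<in> E} = {c, l}" if l: "l \<in> S" for l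
  proof -
    note e = sE[OF leafS[OF l]]
    have "s l \<noteq> c" using e edgeD(4)[OF e] l by (auto simp: S_def)
    moreover have nl: "\<not> leaf (s l)" using no_adjacent_leaves[OF c leafS[OF l]] e by blast
    moreover have sV: "s l \<in> V" using edgeD[OF e] by blast
    ultimately obtain l' where l': "leaf l'" "{y. {s l, y} \<in> E} = {c, l'}" using inner by blast
    have "l \<in> {y. {s l, y} \<in> E}" using edgeD(4)[OF e] by simp
    moreover have "l \<noteq> c" using leafS[OF l] c by auto
    ultimately have "l' = l" using l' by auto
    then show ?thesis using \<open>s l \<noteq> c\<close> nl sV l' by simp
  qed
  have innerS: "\<exists>l\<in>S. x = s l" if x: "x \<in> V" "\<not> leaf x" "x \<noteq> c" for x
  proof -
    obtain l where l: "leaf l" "{y. {x, y} \<in> E} = {c, l}" using inner x by blast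
    then have "{l, x} \<in> E" using edgeD(4)[of x l] by auto
    then have "x = s l" using s l by blast
    moreover have "l \<in> S" using l s[OF l(1), of c] x(3) \<open>x = s l\<close> edgeD(4)[of c l]
      by (auto simp: S_def leaves_def)
    ultimately show ?thesis by blast
  qed
  have edgeS: "{c, s l} \<in> E" if "l \<in> S" for l
  proof -
    have "c \<in> {y. {s l, y} \<in> E}" using sS[OF that] by simp
    then show ?thesis using edgeD(4)[of "s l" c] by simp
  qed
  let ?E = "(\<lambda>l. {c, l}) ` (leaves - S) \<union> (\<lambda>l. {c, s l}) ` S \<union> (\<lambda>l. {s l, l}) ` S"
  have sub1: "{x, y} \<in> ?E" if xy: "{x, y} \<in> E" and x: "leaf x" for x y
  proof (cases "x \<in> S")
    case True
    then show ?thesis using s[OF x, of y] xy by (auto simp: insert_commute)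
  next
    case False
    then have "{c, x} \<in> E" using x by (auto simp: S_def leaves_def)
    then have "{x, c} \<in> E" by (rule edgeD)
    then have "y = c" using s[OF x, of c] s[OF x, of y] xy by simp
    then show ?thesis using False x by (auto simp: insert_commute leaves_def)
  qed
  have sub2: "{c, y} \<in> ?E" if "{c, y} \<in> E" "\<not> leaf y" for y
    using innerS[of y] that edgeD[OF that(1)] by auto
  have "E \<subseteq> ?E"
  proof
    fix e assume e: "e \<in> E"
    then obtain x y where xy: "e = {x, y}" by (auto elim: edgeE)
    then have E: "{x, y} \<in> E" "{y, x} \<in> E" using e edgeD(4) by auto
    consider "leaf x" | "leaf y" | "\<not> leaf x" "\<not> leaf y" "x = c" | "\<not> leaf x" "\<not> leaf y" "y = c"
      | "\<not> leaf x" "\<not> leaf y" "x \<noteq> c" "y \<noteq> c" by blast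
    then show "e \<in> ?E"
    proof cases
      case 1
      then show ?thesis using sub1 E xy by simp
    next
      case 2
      then have "{y, x} \<in> ?E" using sub1 E by simp
      then show ?thesis using xy by (simp only: insert_commute)
    next
      case 3
      then show ?thesis using sub2 E xy by simp
    next
      case 4
      then have "{y, x} \<in> ?E" using sub2 E by simp
      then show ?thesis using xy by (simp only: insert_commute)
    next
      \<comment> \<open>Two inner vertices other than \<open>c\<close> are never adjacent: besides
        \<open>c\<close>, the vertex \<open>x\<close> has only a leaf as neighbour.\<close>
      case 5
      then obtain l where l: "leaf l" "{y. {x, y} \<in> E} = {c, l}" using inner edgeD(1)[OF E(1)] by blast
      then have "y \<in> {c, l}" using E by blast
      then show ?thesis using 5 l by auto
    qed
  qed
  moreover have "?E \<subseteq> E"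
    using edgeS sE leafS edgeD(4) by (fastforce simp: S_def)
  ultimately have E_eq: "E = ?E" by (rule equalityI)
  have leavesV: "leaves \<subseteq> V" using edgeD(1) unfolding leaves_def leaf_def by blast
  have "s ` S \<subseteq> V" using sS by blast
  moreover have "V \<subseteq> insert c leaves \<union> s ` S" using innerS by (auto 4 3 simp: leaves_def)
  ultimately have V_eq: "V = insert c leaves \<union> s ` S" using leavesV c by blast
  have "inj_on s S"
  proof (rule inj_onI)
    fix l l' assume l: "l \<in> S" "l' \<in> S" "s l = s l'"
    then have "{c, l} = {c, l'}" using sS[of l] sS[of l'] by auto
    then show "l = l'" by (auto simp: doubleton_eq_iff)
  qed
  moreover have "finite leaves" using leavesV finite_V finite_subset by blast
  moreover have "s ` S \<inter> insert c leaves = {}" using sS by (auto simp: leaves_def)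
  moreover have "S \<subseteq> leaves - {l0}" using l0 by (auto simp: S_def)
  moreover have "l0 \<in> leaves" "c \<notin> leaves" using l0 c by (auto simp: leaves_def)
  ultimately show ?thesis
    unfolding star_subdivision_def using V_eq E_eq by blast
qed

text \<open>Two branches missed by a resolving set would leave their vertices next to
  \<open>c\<close> unresolved, so the set has at least \<open>card L - 1\<close> elements; on the
  other hand, \<open>card L\<close> edges suffice for a cover.\<close>

lemma star_subdivision_lower_bound:
  assumes "star_subdivision V E"
  shows "edge_cover_number V E - 1 \<le> nl_dim V E"
proof -
  obtain c L l0 S s where L: "finite L" "l0 \<in> L" "c \<notin> L" "S \<subseteq> L - {l0}" "inj_on s S"
    "s ` S \<inter> insert c L = {}" and V_eq: "V = insert c L \<union> s ` S"
    and E_eq: "E = (\<lambda>l. {c, l}) ` (L - S) \<union> (\<lambda>l. {c, s l}) ` S \<union> (\<lambda>l. {s l, l}) ` S"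
    using assms unfolding star_subdivision_def by (elim exE conjE) (rule that)
  have sS: "s l \<noteq> c" "s l \<notin> L" "s l = s l' \<longleftrightarrow> l = l'" if "l \<in> S" "l' \<in> S" for l l'
    using L that by (auto simp: inj_on_def)
  \<comment> \<open>The neighbour of \<open>c\<close> in the branch of \<open>l\<close>; the branch
    itself is \<open>{l, t l}\<close>.\<close>
  define t where "t l = (if l \<in> S then s l else l)" for l
  have t_edge: "{c, t l} \<in> E" if "l \<in> L" for l
    using that unfolding E_eq t_def by auto
  have nb_l: "y = t l" if "l \<in> S" "{l, y} \<in> E" for l y
  proof -
    have "l \<in> L" "l \<noteq> c" using L that(1) by auto
    then show ?thesis using that sS L(3) unfolding E_eq t_def by (auto simp: doubleton_eq_iff)
  qed
  have nb_t: "y = c \<or> y = l" if l: "l \<in> L" and e: "{t l, y} \<in> E" for l y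
  proof (cases "l \<in> S")
    case True
    then show ?thesis using e sS L unfolding E_eq t_def by (auto simp: doubleton_eq_iff)
  next
    case False
    then show ?thesis using l e sS L unfolding E_eq t_def by (auto simp: doubleton_eq_iff)
  qed
  have t_inj: "{l, t l} \<inter> {l', t l'} = {}" if "l \<in> L" "l' \<in> L" "l \<noteq> l'" for l l'
    using that sS unfolding t_def by auto
  have t_V: "t l \<in> V" "l \<in> V" "t l \<noteq> c" if "l \<in> L" for l
    using that L sS unfolding V_eq t_def by auto
  have "c \<in> V" using V_eq by simp
  \<comment> \<open>From \<open>t l\<close>, everything outside the branch is reached through
    \<open>c\<close>: a geodesic entering \<open>l\<close> would have to return to
    \<open>t l\<close>.\<close>
  have branch: "d (t l) x = Suc (d c x)" if l: "l \<in> L" and x: "x \<in> V" "x \<notin> {l, t l}" for l x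
  proof -
    obtain y where y: "{t l, y} \<in> E" "d (t l) x = Suc (d y x)"
      using ex_closer[of "t l" x] t_V l x by auto
    have "y \<noteq> l"
    proof
      assume "y = l"
      then have "l \<in> S" using edgeD(3)[OF y(1)] by (auto simp: t_def split: if_splits)
      obtain z where z: "{l, z} \<in> E" "d l x = Suc (d z x)"
        using ex_closer[of l x] t_V l x by auto
      then show False using nb_l[OF \<open>l \<in> S\<close> z(1)] y \<open>y = l\<close> by simp
    qed
    then show ?thesis using nb_t[OF l y(1)] y(2) by simp
  qed
  obtain X where X: "nonlocal_resolving V E X" "card X = nl_dim V E"
    using ex_min_nonlocal_resolving .
  have XV: "X \<subseteq> V" using X by (simp add: nonlocal_resolving_def)
  \<comment> \<open>The branches that \<open>X\<close> misses; distinct vertices \<open>t l\<close>,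
    \<open>t l'\<close> of such branches are non-adjacent and have equal distances to all of
    \<open>X\<close>.\<close>
  define L0 where "L0 = {l \<in> L. X \<inter> {l, t l} = {}}"
  have L0_unique: "l = l'" if l: "l \<in> L0" "l' \<in> L0" for l l'
  proof (rule ccontr)
    assume "l \<noteq> l'"
    have L': "l \<in> L" "l' \<in> L" using l by (auto simp: L0_def)
    have "t l \<noteq> t l'" "t l' \<noteq> l" using t_inj[OF L' \<open>l \<noteq> l'\<close>] by auto
    then have "{t l, t l'} \<notin> E" using nb_t[OF L'(1)] t_V(3)[OF L'(2)] by blast
    then obtain x where x: "x \<in> X" "d (t l) x \<noteq> d (t l') x"
      using X t_V(1)[OF L'(1)] t_V(1)[OF L'(2)] \<open>t l \<noteq> t l'\<close> unfolding nonlocal_resolving_def by blast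
    have "x \<in> V" "x \<notin> {l, t l}" "x \<notin> {l', t l'}" using x(1) XV l by (auto simp: L0_def)
    then show False using branch[OF L'(1)] branch[OF L'(2)] x(2) by simp
  qed
  have fin0: "finite L0" using L(1) by (auto simp: L0_def)
  have "card L0 \<le> 1" using L0_unique fin0 by (simp add: card_le_Suc0_iff_eq)
  have "\<forall>l\<in>L - L0. \<exists>x. x \<in> X \<and> x \<in> {l, t l}" unfolding L0_def by blast
  from bchoice[OF this] obtain h where h: "\<And>l. l \<in> L - L0 \<Longrightarrow> h l \<in> X \<and> h l \<in> {l, t l}" by blast
  have "inj_on h (L - L0)"
  proof (rule inj_onI, rule ccontr)
    fix l l' assume l: "l \<in> L - L0" "l' \<in> L - L0" "h l = h l'" "l \<noteq> l'"
    have "h l \<in> {l, t l}" "h l \<in> {l', t l'}" using h[OF l(1)] h[OF l(2)] l(3) by simp_all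
    then show False using t_inj[of l l'] l by blast
  qed
  then have "card (L - L0) \<le> card X"
    using h XV finite_V finite_subset by (intro card_inj_on_le[of h]) auto
  moreover have "card L = card L0 + card (L - L0)"
    using card_Diff_subset[of L0 L] card_mono[of L L0] fin0 L(1) by (auto simp: L0_def)
  ultimately have lower: "card L \<le> card X + 1" using \<open>card L0 \<le> 1\<close> by simp

  \<comment> \<open>One edge at each leaf. The centre is covered because the edge to
    \<open>l0\<close> is not subdivided.\<close>
  let ?C = "(\<lambda>l. {if l \<in> S then s l else c, l}) ` L"
  have "edge_cover V E ?C"
    unfolding edge_cover_def
  proof (intro conjI ballI)
    show "?C \<subseteq> E" unfolding E_eq by auto
    fix v assume "v \<in> V"
    then consider "v = c" | "v \<in> L" | l where "l \<in> S" "v = s l" using V_eq by blast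
    then show "\<exists>e\<in>?C. v \<in> e"
    proof cases
      case 1
      have "l0 \<notin> S" using L(4) by auto
      then have "c \<in> (\<lambda>l. {if l \<in> S then s l else c, l}) l0" by simp
      then show ?thesis using 1 L(2) by blast
    next
      case 2
      then show ?thesis by blast
    next
      case 3
      then have "v \<in> (\<lambda>l. {if l \<in> S then s l else c, l}) l" by simp
      then show ?thesis using 3 L(4) by blast
    qed
  qed
  then have "edge_cover_number V E \<le> card ?C" by (rule edge_cover_number_le)
  also have "\<dots> \<le> card L" using L(1) by (rule card_image_le)
  finally show ?thesis using lower X(2) by simp
qed

end

section \<open>Extremal trees are subdivided stars\<close>

context tree_graph
begin

text \<open>An inner vertex of degree at least 3 has to be the centre. If there is none, every inner
  vertex has a pendant leaf and just one further neighbour, and any inner vertex can be the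
  centre.\<close>

lemma star_subdivision_if_pendant_cover:
  assumes pend: "\<And>x. x \<in> V \<Longrightarrow> \<not> leaf x \<Longrightarrow> \<exists>l. leaf l \<and> {x, l} \<in> E"
    and nonres: "\<And>a b. leaf a \<Longrightarrow> leaf b \<Longrightarrow> a \<noteq> b \<Longrightarrow> \<not> nonlocal_resolving V E (leaves - {a, b})"
    and c0: "c0 \<in> V" "\<not> leaf c0"
  shows "star_subdivision V E"
proof (cases "\<exists>c\<in>V. \<not> leaf c \<and> (\<forall>y z. {y'. {c, y'} \<in> E} \<noteq> {y, z})")
  case True
  then obtain c where c: "c \<in> V" "\<not> leaf c" "\<And>y z. {y'. {c, y'} \<in> E} \<noteq> {y, z}" by blast
  obtain l0 where l0: "leaf l0" "{c, l0} \<in> E" using pend c by blast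
  show ?thesis
  proof (rule star_subdivisionI[OF c(1,2) l0])
    fix q assume q: "q \<in> V" "\<not> leaf q" "q \<noteq> c"
    then show "\<exists>l. leaf l \<and> {y. {q, y} \<in> E} = {c, l}"
      using inner_vertex_adjacent_to_branching[OF pend nonres q(1) c(1) q(3,2) c(2) c(3)] by blast
  qed
next
  case False
  then have deg2: "\<exists>y z. {y'. {q, y'} \<in> E} = {y, z}" if "q \<in> V" "\<not> leaf q" for q
    using that by blast
  obtain l0 where l0: "leaf l0" "{c0, l0} \<in> E" using pend c0 by blast
  show ?thesis
  proof (rule star_subdivisionI[OF c0 l0])
    fix q assume q: "q \<in> V" "\<not> leaf q" "q \<noteq> c0"
    obtain r where r: "{q, r} \<in> E" "d q c0 = Suc (d r c0)" using ex_closer q c0 by metis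
    \<comment> \<open>Otherwise \<open>r\<close> would have three neighbours: \<open>q\<close>, the
      next vertex \<open>r'\<close> towards \<open>c0\<close>, and a pendant leaf.\<close>
    have "r = c0"
    proof (rule ccontr)
      assume "r \<noteq> c0"
      have rV: "r \<in> V" using edgeD[OF r(1)] by simp
      obtain r' where r': "{r, r'} \<in> E" "d r c0 = Suc (d r' c0)"
        using ex_closer[OF rV c0(1) \<open>r \<noteq> c0\<close>] .
      have r'V: "r' \<in> V" using edgeD[OF r'(1)] by simp
      have rq: "{r, q} \<in> E" using r edgeD(4) by blast
      have "r' \<noteq> q" using r r' by auto
      then have "\<not> leaf r" unfolding leaf_def using r' rq by blast
      have "\<not> leaf r'"
      proof (cases "r' = c0")
        case False
        obtain r'' where r'': "{r', r''} \<in> E" "d r' c0 = Suc (d r'' c0)"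
          using ex_closer[OF r'V c0(1) False] .
        then have "r'' \<noteq> r" using r' by auto
        then show ?thesis unfolding leaf_def using r'' edgeD(4)[OF r'(1)] by blast
      qed (use c0 in simp)
      obtain l where l: "leaf l" "{r, l} \<in> E" using pend rV \<open>\<not> leaf r\<close> by blast
      obtain y z where yz: "{y'. {r, y'} \<in> E} = {y, z}" using deg2 rV \<open>\<not> leaf r\<close> by blast
      have "q \<in> {y, z}" "r' \<in> {y, z}" "l \<in> {y, z}" using yz rq r' l by blast+
      moreover have "l \<noteq> q" "l \<noteq> r'" using l q \<open>\<not> leaf r'\<close> by auto
      ultimately show False using \<open>r' \<noteq> q\<close> by auto
    qed
    obtain l where l: "leaf l" "{q, l} \<in> E" using pend q by blast
    obtain y z where yz: "{y'. {q, y'} \<in> E} = {y, z}" using deg2 q by blast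
    have "c0 \<in> {y, z}" "l \<in> {y, z}" using yz r l \<open>r = c0\<close> by blast+
    moreover have "c0 \<noteq> l" using l c0 by auto
    ultimately have "{y, z} = {c0, l}" by auto
    then show "\<exists>l. leaf l \<and> {y. {q, y} \<in> E} = {c0, l}" using l yz by auto
  qed
qed

text \<open>Pendant edges embed the leaves into a minimum cover \<open>C\<close>, while the leaves
  without one resolve the tree. Extremality turns both estimates into equalities, so
  \<open>C\<close> consists of the pendant edges and no two leaves can be spared.\<close>

lemma star_subdivision_if_extremal:
  assumes card_V: "card V \<ge> 2" and ext: "nl_dim V E = edge_cover_number V E - 1"
  shows "star_subdivision V E"
proof (cases "\<exists>c\<in>V. \<not> leaf c")
  case False
  have "V \<noteq> {}" using card_V by auto
  then obtain a where a: "a \<in> V" "leaf a" using False by blast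
  then obtain b where ab: "{a, b} \<in> E" unfolding leaf_def by blast
  have b: "b \<in> V" "leaf b" "a \<noteq> b" using edgeD[OF ab] False by auto
  \<comment> \<open>If all vertices are leaves, the tree is a single edge, the star with one edge;
    either end serves as centre.\<close>
  have V_eq: "V = {a, b}"
  proof (rule ccontr)
    assume "V \<noteq> {a, b}"
    then obtain x where x: "x \<in> V" "x \<noteq> a" "x \<noteq> b" using a b by blast
    have "d a x = Suc (d b x)" using leaf_dist[OF a(2) ab] x by simp
    moreover have "d b x = Suc (d a x)" using leaf_dist[OF b(2) edgeD(4)[OF ab]] x by simp
    ultimately show False by simp
  qed
  have "E \<subseteq> {{a, b}}"
  proof
    fix e assume "e \<in> E"
    then obtain u v where "e = {u, v}" "u \<noteq> v" "u \<in> V" "v \<in> V" by (rule edgeE)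
    then show "e \<in> {{a, b}}" using V_eq by auto
  qed
  then have "E = {{a, b}}" using ab by blast
  then show ?thesis
    unfolding star_subdivision_def using V_eq b
    by - (rule exI[of _ a], rule exI[of _ "{b}"], rule exI[of _ b], rule exI[of _ "{}"], auto)
next
  case True
  then obtain c where c: "c \<in> V" "\<not> leaf c" by blast
  obtain C where C: "edge_cover V E C" "card C = edge_cover_number V E"
    using ex_min_edge_cover[OF card_V] .
  have finC: "finite C" using C finite_E finite_subset by (auto simp: edge_cover_def)
  have "\<forall>l\<in>leaves. \<exists>y. {l, y} \<in> E" unfolding leaves_def leaf_def by blast
  from bchoice[OF this] obtain s where s: "\<And>l. l \<in> leaves \<Longrightarrow> {l, s l} \<in> E" by blast
  have s_unique: "y = s l" if "l \<in> leaves" "{l, y} \<in> E" for l y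
    using s[OF that(1)] that unfolding leaves_def leaf_def by blast
  define P where "P l = {l, s l}" for l
  have injP: "inj_on P leaves"
  proof (rule inj_onI, rule ccontr)
    fix l l' assume l: "l \<in> leaves" "l' \<in> leaves" "P l = P l'" "l \<noteq> l'"
    then have "s l = l'" by (auto simp: P_def doubleton_eq_iff)
    then show False using no_adjacent_leaves[OF c] s l by (auto simp: leaves_def)
  qed
  have PC: "P ` leaves \<subseteq> C"
  proof
    fix e assume "e \<in> P ` leaves"
    then obtain l where l: "l \<in> leaves" "e = P l" by blast
    then have "l \<in> V" using leaf_in_V by (simp add: leaves_def)
    then obtain e' where e': "e' \<in> C" "l \<in> e'" using C by (auto simp: edge_cover_def)
    then have "e' \<in> E" using C by (auto simp: edge_cover_def)
    then obtain u v where "e' = {u, v}" by (rule edgeE)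
    then obtain y where y: "e' = {l, y}" using e'(2) by auto
    then have "y = s l" using s_unique l \<open>e' \<in> E\<close> by simp
    then show "e \<in> C" using y e' l by (simp add: P_def)
  qed
  have le: "card leaves \<le> card C" using card_mono[OF finC PC] card_image[OF injP] by simp
  obtain w where w: "w \<in> V" "w \<noteq> c"
    using card_V c finite_V by (metis card_le_Suc0_iff_eq not_less_eq_eq numeral_2_eq_2)
  then obtain a where a: "leaf a" using ex_leaf_behind c by metis
  have "a \<in> leaves" using a by (simp add: leaves_def)
  have "nl_dim V E \<le> card leaves - 1"
    using nl_dim_le[OF leaves_minus_one_resolving[of a]] \<open>a \<in> leaves\<close> by simp
  \<comment> \<open>Needed because of truncated subtraction:
    \<open>card C - 1 \<le> card leaves - 1\<close> must yield
    \<open>card C \<le> card leaves\<close>.\<close>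
  moreover have "card leaves \<ge> 1"
    using \<open>a \<in> leaves\<close> finite_leaves by (metis One_nat_def Suc_leI card_gt_0_iff empty_iff)
  ultimately have card_eq: "card C = card leaves" using ext C(2) le by simp
  then have C_eq: "P ` leaves = C"
    using card_subset_eq[OF finC PC] card_image[OF injP] by simp
  show ?thesis
  proof (rule star_subdivision_if_pendant_cover[OF _ _ c])
    fix x assume x: "x \<in> V" "\<not> leaf x"
    then obtain e where e: "e \<in> C" "x \<in> e" using C by (auto simp: edge_cover_def)
    then obtain l where l: "l \<in> leaves" "e = P l" using C_eq by blast
    then have "x = s l" using e x by (auto simp: P_def leaves_def)
    then have "{x, l} \<in> E" using edgeD(4)[OF s[OF l(1)]] by simp
    then show "\<exists>l. leaf l \<and> {x, l} \<in> E" using l by (auto simp: leaves_def)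
  next
    fix u v assume uv: "leaf u" "leaf v" "u \<noteq> v"
    show "\<not> nonlocal_resolving V E (leaves - {u, v})"
    proof
      assume "nonlocal_resolving V E (leaves - {u, v})"
      then have "nl_dim V E \<le> card (leaves - {u, v})" by (rule nl_dim_le)
      moreover have "{u, v} \<subseteq> leaves" using uv by (auto simp: leaves_def)
      moreover have "card {u, v} = 2" using uv by simp
      ultimately show False
        using ext card_eq C(2) card_Diff_subset[of "{u, v}" leaves] card_mono[OF finite_leaves, of "{u, v}"]
        by simp
    qed
  qed
qed

end

theorem theorem5p3:
  fixes V :: "'a set" and E :: "'a set set"
  assumes "graph V E" and "connected V E" and "card V \<ge> 2" and "girth V E \<ge> 7"
  shows "nl_dim V E \<le> edge_cover_number V E - 1 \<and>
    (is_tree V E \<longrightarrow>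
       (nl_dim V E = edge_cover_number V E - 1 \<longleftrightarrow> star_subdivision V E))"
proof (intro conjI impI)
  interpret girth7_graph V E using assms by unfold_locales
  show bound: "nl_dim V E \<le> edge_cover_number V E - 1" by (rule nl_dim_bound)
  assume "is_tree V E"
  then interpret tree_graph V E by unfold_locales (simp add: is_tree_def)
  show "nl_dim V E = edge_cover_number V E - 1 \<longleftrightarrow> star_subdivision V E"
    using bound star_subdivision_lower_bound star_subdivision_if_extremal[OF assms(3)] by auto
qed

end
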